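(* Let $n,m\in\mathbb{N}$ (positive integers) be such that $n\le m$. Then i) $\varepsilon(n,m)\le\varepsilon(n-1,m)$ and $\varepsilon(n,m)\le\varepsilon(n,m+1)$; ii) $\varepsilon(n,m)\le\varepsilon(n-1,m-1)\le\dots\le\varepsilon(1,m-n+1)=\frac{m-n}{2(m-n+1)}$.
   Context: For integers $0\le n\le m$, define $$\varepsilon(n,m)=\sup\{\varepsilon\ge0\mid \mu(Z,\mathbb{Z}^k)\le 1-2\varepsilon\text{ for all lattice zonotopes }Z\subseteq\mathbb{R}^k\text{ generated by } m\text{ vectors of }\mathbb{Z}^k\text{ in linear general position and where }0\le k\le n\}.$$ Here the zonotope generated by $z_1,\dots,z_m\in\mathbb{Z}^k$ is $\sum_{i=1}^m[0,z_i]$ (Minkowski sum of segments), the family $z_1,\dots,z_m$ (repetitions allowed) is in linear general position if any $k$ of its members (at distinct indices) are linearly independent, and $\mu(K,\mathbb{Z}^k)=\inf\{\rho>0\mid\rho K+\mathbb{Z}^k=\mathbb{R}^k\}$ is the covering radius. For $k=0$ the zonotope is the point $\mathbb{R}^0$, with $\mu=0$, so that $\varepsilon(0,m)=1/2$. *)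

theory Defs
  imports Complex_Main "Jordan_Normal_Form.VS_Connect"
begin

text \<open>
  The dimension \<open>k\<close> varies inside the definition of \<open>zonotope_eps\<close>, so \<open>\<real>\<^sup>k\<close> is the carrier
  \<open>carrier_vec k\<close> of \<^typ>\<open>real vec\<close>. A family \<open>z\<^sub>1, \<dots>, z\<^sub>m\<close> is a function \<open>z\<close> on \<open>nat\<close> of which
  only the values at the indices \<open>i < m\<close> are used; it may have repeated members.
\<close>

definition int_lattice :: "nat \<Rightarrow> real vec set" where
  "int_lattice k = {v \<in> carrier_vec k. \<forall>i<k. v $ i \<in> \<int>}"

definition origin_segment :: "real vec \<Rightarrow> real vec set" where
  "origin_segment v = {t \<cdot>\<^sub>v v | t. 0 \<le> t \<and> t \<le> 1}"

definition zonotope :: "nat \<Rightarrow> nat \<Rightarrow> (nat \<Rightarrow> real vec) \<Rightarrow> real vec set" where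
  "zonotope k m z =
     {finsum_vec TYPE(real) k y {..<m} | y. \<forall>i<m. y i \<in> origin_segment (z i)}"

text \<open>
  The library's \<open>lin_dep\<close> speaks about sets of vectors; independence of the family
  \<open>(z i)\<^bsub>i \<in> I\<^esub>\<close> therefore also requires that no vector is repeated on \<open>I\<close>.
\<close>

definition linear_general_position :: "nat \<Rightarrow> nat \<Rightarrow> (nat \<Rightarrow> real vec) \<Rightarrow> bool" where
  "linear_general_position k m z \<longleftrightarrow>
     (\<forall>I. I \<subseteq> {..<m} \<and> card I = k \<longrightarrow>
        inj_on z I \<and> \<not> module.lin_dep class_ring (module_vec TYPE(real) k) (z ` I))"

text \<open>
  The infimum and supremum below are those of \<^typ>\<open>real\<close>, so they carry their usual meaning only
  for nonempty bounded sets. This is the case for the lattice zonotopes that occur when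
  \<open>n \<le> m\<close>; nothing is intended for \<open>n > m\<close>.
\<close>

definition covering_radius :: "nat \<Rightarrow> real vec set \<Rightarrow> real" where
  "covering_radius k K =
     Inf {\<rho>. \<rho> > 0 \<and> {\<rho> \<cdot>\<^sub>v x + l | x l. x \<in> K \<and> l \<in> int_lattice k} = carrier_vec k}"

definition zonotope_eps :: "nat \<Rightarrow> nat \<Rightarrow> real" where
  "zonotope_eps n m =
     Sup {\<epsilon>. \<epsilon> \<ge> 0 \<and>
       (\<forall>k\<le>n. \<forall>z. (\<forall>i<m. z i \<in> int_lattice k) \<and> linear_general_position k m z \<longrightarrow>
          covering_radius k (zonotope k m z) \<le> 1 - 2 * \<epsilon>)}"

end

theory Submission
  imports Defs
begin

text \<open>
  Call \<open>\<epsilon>\<close> admissible for \<open>(n, m)\<close> if it belongs to the set whose supremum is \<open>\<epsilon>(n, m)\<close>. For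
  \<open>n \<le> m\<close> this set contains \<open>0\<close> and is bounded by \<open>1/2\<close>. It contains \<open>0\<close> because \<open>k\<close> of the
  generators span a parallelepiped whose translates by the lattice points cover space
  (\<open>lattice_covers_parallelepiped\<close>), and it is bounded because in dimension \<open>0\<close> the covering radius
  is \<open>0\<close>. Each of the inequalities therefore follows from an inclusion of admissible sets. The
  first inclusion is immediate, the other two compare a given zonotope with one whose covering
  radius is at least as large and which the admissibility hypothesis bounds:

  \<^item> admissibility for \<open>(n, m)\<close> constrains all dimensions up to \<open>n\<close>, hence implies admissibility for
    \<open>(n - 1, m)\<close>;
  \<^item> removing a generator makes a zonotope smaller and keeps general position, which compares
    \<open>(n, m)\<close> with \<open>(n, m + 1)\<close>;
  \<^item> a lattice zonotope \<open>Z\<close> in \<open>\<real>\<^sup>k\<close> with \<open>m\<close> generators in general position is the projection of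
    one in dimension \<open>k + 1\<close> with \<open>m + 1\<close> generators in general position: give the \<open>i\<close>-th
    generator the height \<open>N ^ i\<close> and add the vertical unit vector, which projects to \<open>0\<close>. As the
    lattice projects onto the lattice, the covering radius does not increase
    (\<open>lattice_covers_project\<close>). General position of the lifted family holds for all \<open>N\<close> outside
    the zero set of finitely many nonzero polynomials (\<open>exists_generic_lift\<close>).

  In dimension \<open>1\<close> a zonotope with generators \<open>z\<^sub>i\<close> is an interval of length
  \<open>\<Sum> \<bar>z\<^sub>i\<bar> \<ge> m\<close>, with equality when all generators are \<open>1\<close>. So the largest covering radius is
  \<open>1 / m\<close>, and \<open>\<epsilon>(1, m) = (1 - 1 / m) / 2\<close>.
\<close>

section \<open>Linear independence of families in coordinates\<close>

definition indpt_family :: "nat \<Rightarrow> (nat \<Rightarrow> real vec) \<Rightarrow> nat set \<Rightarrow> bool" where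
  "indpt_family k z I \<longleftrightarrow>
     (\<forall>c. (\<forall>j<k. (\<Sum>i\<in>I. c i * z i $ j) = 0) \<longrightarrow> (\<forall>i\<in>I. c i = 0))"

lemma indpt_family_iff:
  assumes "finite I" and zC: "\<And>i. i \<in> I \<Longrightarrow> z i \<in> carrier_vec k"
  shows "indpt_family k z I \<longleftrightarrow>
    inj_on z I \<and> \<not> module.lin_dep class_ring (module_vec TYPE(real) k) (z ` I)"
proof -
  interpret vec_space "TYPE(real)" k .
  have sub: "z ` I \<subseteq> carrier_vec k" using zC by auto
  have coord: "lincomb a (z ` I) $ j = (\<Sum>i\<in>I. a (z i) * z i $ j)"
    if "inj_on z I" "j < k" for a j
    using that sub by (simp add: lincomb_index sum.reindex)
  show ?thesis
  proof (intro iffI conjI)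
    assume ind: "indpt_family k z I"
    show inj: "inj_on z I"
    proof (rule inj_onI, rule ccontr)
      fix a b assume ab: "a \<in> I" "b \<in> I" "z a = z b" "a \<noteq> b"
      define c where "c i = (if i = a then 1 else if i = b then - 1 else (0::real))" for i
      have "(\<Sum>i\<in>I. c i * z i $ j) = 0" for j
      proof -
        have "(\<Sum>i\<in>I. c i * z i $ j) = (\<Sum>i\<in>{a, b}. c i * z i $ j)"
          by (rule sum.mono_neutral_right) (use assms(1) ab in \<open>auto simp: c_def\<close>)
        also have "\<dots> = 0" using ab by (simp add: c_def)
        finally show ?thesis .
      qed
      hence "c a = 0" using ind ab(1) unfolding indpt_family_def by blast
      thus False by (simp add: c_def)
    qed
    show "lin_indpt (z ` I)"
    proof (rule finite_lin_indpt2)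
      fix a assume "lincomb a (z ` I) = 0\<^sub>v k"
      hence "(\<Sum>i\<in>I. a (z i) * z i $ j) = 0" if "j < k" for j
        using coord[OF inj that, of a] that by (simp add: module_vec_simps)
      hence "\<forall>i\<in>I. a (z i) = 0"
        using ind[unfolded indpt_family_def, rule_format, of "\<lambda>i. a (z i)"] by blast
      thus "\<forall>v\<in>z ` I. a v = 0" by simp
    qed (use assms(1) sub in auto)
  next
    assume r: "inj_on z I \<and> lin_indpt (z ` I)"
    show "indpt_family k z I"
      unfolding indpt_family_def
    proof (intro allI impI ballI, rule ccontr)
      fix c i assume c: "\<forall>j<k. (\<Sum>i\<in>I. c i * z i $ j) = 0" and i: "i \<in> I" "c i \<noteq> 0"
      define a where "a v = c (inv_into I z v)" for v
      have az: "a (z i) = c i" if "i \<in> I" for i using r that by (simp add: a_def)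
      have "lincomb a (z ` I) = 0\<^sub>v k"
      proof (rule eq_vecI)
        fix j assume "j < dim_vec (0\<^sub>v k :: real vec)"
        hence "j < k" by simp
        have "lincomb a (z ` I) $ j = (\<Sum>i\<in>I. a (z i) * z i $ j)"
          using coord r \<open>j < k\<close> by blast
        also have "\<dots> = (\<Sum>i\<in>I. c i * z i $ j)" by (rule sum.cong) (auto simp: az)
        finally show "lincomb a (z ` I) $ j = 0\<^sub>v k $ j" using c \<open>j < k\<close> by simp
      qed (use sub assms(1) in \<open>simp add: lincomb_dim\<close>)
      hence "lin_dep (z ` I)"
        by (intro lin_dep_crit[where A = "z ` I" and a = a and v = "z i"])
           (use assms(1) i az in \<open>auto simp: module_vec_simps\<close>)
      thus False using r by blast
    qed
  qed
qed

lemma linear_general_position_iff: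
  assumes "\<And>i. i < m \<Longrightarrow> z i \<in> carrier_vec k"
  shows "linear_general_position k m z \<longleftrightarrow>
    (\<forall>I. I \<subseteq> {..<m} \<and> card I = k \<longrightarrow> indpt_family k z I)"
proof -
  have "indpt_family k z I \<longleftrightarrow>
      inj_on z I \<and> \<not> module.lin_dep class_ring (module_vec TYPE(real) k) (z ` I)"
    if "I \<subseteq> {..<m}" for I
    using that assms finite_subset[OF that] by (intro indpt_family_iff) auto
  thus ?thesis unfolding linear_general_position_def by blast
qed

lemma indpt_family_card_le:
  assumes "finite I" "\<And>i. i \<in> I \<Longrightarrow> z i \<in> carrier_vec k" "indpt_family k z I"
  shows "card I \<le> k"
proof -
  interpret vec_space "TYPE(real)" k .
  have r: "inj_on z I \<and> lin_indpt (z ` I)" using indpt_family_iff assms by blast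
  have "card (z ` I) \<le> dim" by (rule li_le_dim) (use assms r in auto)
  thus ?thesis using r by (simp add: card_image dim_is_n)
qed

lemma indpt_family_spans:
  assumes "finite I" "\<And>i. i \<in> I \<Longrightarrow> z i \<in> carrier_vec k" "indpt_family k z I"
    and "card I = k" and x: "x \<in> carrier_vec k"
  shows "\<exists>c. \<forall>j<k. x $ j = (\<Sum>i\<in>I. c i * z i $ j)"
proof -
  interpret vec_space "TYPE(real)" k .
  have r: "inj_on z I \<and> lin_indpt (z ` I)" using indpt_family_iff assms by blast
  have sub: "z ` I \<subseteq> carrier_vec k" using assms by auto
  have "basis (z ` I)"
    by (rule dim_li_is_basis) (use assms r sub in \<open>auto simp: card_image dim_is_n\<close>)
  hence "x \<in> span (z ` I)" using x unfolding basis_def by auto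
  then obtain a where "x = lincomb a (z ` I)"
    using finite_span[of "z ` I"] sub assms(1) by auto
  hence "x $ j = (\<Sum>i\<in>I. a (z i) * z i $ j)" if "j < k" for j
    using that sub r by (simp add: lincomb_index sum.reindex)
  thus ?thesis by (intro exI[of _ "\<lambda>i. a (z i)"]) auto
qed

section \<open>Lattice coverings by dilated zonotopes\<close>

definition lattice_covers :: "nat \<Rightarrow> real vec set \<Rightarrow> real \<Rightarrow> bool" where
  "lattice_covers k K \<rho> \<longleftrightarrow>
     \<rho> > 0 \<and> {\<rho> \<cdot>\<^sub>v x + l | x l. x \<in> K \<and> l \<in> int_lattice k} = carrier_vec k"

lemma covering_radius_eq_Inf: "covering_radius k K = Inf {\<rho>. lattice_covers k K \<rho>}"
  by (simp add: covering_radius_def lattice_covers_def)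

lemma int_latticeD: "v \<in> int_lattice k \<Longrightarrow> v \<in> carrier_vec k"
  by (simp add: int_lattice_def)

lemma covering_radius_le:
  assumes "lattice_covers k K \<rho>"
  shows "covering_radius k K \<le> \<rho>"
  unfolding covering_radius_eq_Inf
  by (rule cInf_lower) (use assms in \<open>auto simp: lattice_covers_def intro!: bdd_belowI[of _ 0]\<close>)

text \<open>
  The factor \<open>\<rho>\<^sub>0\<close> guarantees that the larger infimum is not the one of the empty set, for which
  no inequality could be concluded.
\<close>

lemma covering_radius_mono:
  assumes "lattice_covers k K \<rho>\<^sub>0"
    and "\<And>\<rho>. lattice_covers k K \<rho> \<Longrightarrow> lattice_covers k' K' \<rho>"
  shows "covering_radius k' K' \<le> covering_radius k K"
  unfolding covering_radius_eq_Inf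
  by (rule cInf_superset_mono)
     (use assms in \<open>auto simp: lattice_covers_def intro!: bdd_belowI[of _ 0]\<close>)

lemma zonotope_eq:
  assumes zC: "\<And>i. i < m \<Longrightarrow> z i \<in> carrier_vec k"
  shows "zonotope k m z =
    {vec k (\<lambda>j. \<Sum>i<m. t i * z i $ j) | t. \<forall>i<m. 0 \<le> t i \<and> t i \<le> 1}"
proof -
  have eq: "finsum_vec TYPE(real) k y {..<m} = vec k (\<lambda>j. \<Sum>i<m. t i * z i $ j)"
    if y: "\<And>i. i < m \<Longrightarrow> y i = t i \<cdot>\<^sub>v z i" for y t
  proof (rule eq_vecI)
    have yC: "y \<in> {..<m} \<rightarrow> carrier_vec k" using y zC by auto
    have "finsum_vec TYPE(real) k y {..<m} \<in> carrier_vec k"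
      using finsum_vec_closed[OF yC] .
    thus "dim_vec (finsum_vec TYPE(real) k y {..<m}) =
        dim_vec (vec k (\<lambda>j. \<Sum>i<m. t i * z i $ j))" by simp
    fix j assume "j < dim_vec (vec k (\<lambda>j. \<Sum>i<m. t i * z i $ j))"
    hence j: "j < k" by simp
    have "finsum_vec TYPE(real) k y {..<m} $ j = (\<Sum>i<m. y i $ j)"
      by (rule index_finsum_vec) (use j yC in auto)
    also have "\<dots> = (\<Sum>i<m. t i * z i $ j)"
      by (rule sum.cong) (use j y zC[THEN carrier_vecD] in auto)
    finally show "finsum_vec TYPE(real) k y {..<m} $ j =
        vec k (\<lambda>j. \<Sum>i<m. t i * z i $ j) $ j" using j by simp
  qed
  show ?thesis
  proof (intro equalityI subsetI)
    fix x assume "x \<in> zonotope k m z"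
    then obtain y where x: "x = finsum_vec TYPE(real) k y {..<m}"
      and "\<forall>i<m. y i \<in> origin_segment (z i)" unfolding zonotope_def by blast
    hence "\<forall>i. \<exists>t. i < m \<longrightarrow> y i = t \<cdot>\<^sub>v z i \<and> 0 \<le> t \<and> t \<le> 1"
      unfolding origin_segment_def by blast
    then obtain t where "\<And>i. i < m \<Longrightarrow> y i = t i \<cdot>\<^sub>v z i \<and> 0 \<le> t i \<and> t i \<le> 1"
      by metis
    thus "x \<in> {vec k (\<lambda>j. \<Sum>i<m. t i * z i $ j) | t. \<forall>i<m. 0 \<le> t i \<and> t i \<le> 1}"
      using eq[of y t] x by blast
  next
    fix x assume "x \<in> {vec k (\<lambda>j. \<Sum>i<m. t i * z i $ j) | t. \<forall>i<m. 0 \<le> t i \<and> t i \<le> 1}"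
    then obtain t where x: "x = vec k (\<lambda>j. \<Sum>i<m. t i * z i $ j)"
      and t: "\<forall>i<m. 0 \<le> t i \<and> t i \<le> 1" by blast
    have "x = finsum_vec TYPE(real) k (\<lambda>i. t i \<cdot>\<^sub>v z i) {..<m}"
      using eq[of "\<lambda>i. t i \<cdot>\<^sub>v z i" t] x by simp
    thus "x \<in> zonotope k m z" using t unfolding zonotope_def origin_segment_def by blast
  qed
qed

text \<open>
  Working with the coefficients \<open>t\<close> of a point of the zonotope reduces all comparisons of
  coverings below to manipulations of real sums.
\<close>

lemma lattice_covers_zonotope_iff:
  assumes zC: "\<And>i. i < m \<Longrightarrow> z i \<in> carrier_vec k"
  shows "lattice_covers k (zonotope k m z) \<rho> \<longleftrightarrow> \<rho> > 0 \<and>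
    (\<forall>x\<in>carrier_vec k. \<exists>t. (\<forall>i<m. 0 \<le> t i \<and> t i \<le> 1) \<and>
       (\<forall>j<k. x $ j - \<rho> * (\<Sum>i<m. t i * z i $ j) \<in> \<int>))"
proof -
  let ?w = "\<lambda>t. vec k (\<lambda>j. \<Sum>i<m. t i * z i $ j)"
  let ?S = "{\<rho> \<cdot>\<^sub>v x + l | x l. x \<in> zonotope k m z \<and> l \<in> int_lattice k}"
  have Z: "zonotope k m z = {?w t | t. \<forall>i<m. 0 \<le> t i \<and> t i \<le> 1}"
    by (rule zonotope_eq) (rule zC)
  have S: "x \<in> ?S \<longleftrightarrow> x \<in> carrier_vec k \<and> (\<exists>t. (\<forall>i<m. 0 \<le> t i \<and> t i \<le> 1) \<and>
       (\<forall>j<k. x $ j - \<rho> * (\<Sum>i<m. t i * z i $ j) \<in> \<int>))" for x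
  proof
    assume "x \<in> ?S"
    then obtain t l where t: "\<forall>i<m. 0 \<le> t i \<and> t i \<le> 1" and l: "l \<in> int_lattice k"
      and x: "x = \<rho> \<cdot>\<^sub>v ?w t + l"
      unfolding Z by blast
    have "\<forall>j<k. x $ j - \<rho> * (\<Sum>i<m. t i * z i $ j) \<in> \<int>"
      using l by (auto simp: x int_lattice_def carrier_vecD)
    moreover have "x \<in> carrier_vec k" using l by (simp add: x int_latticeD)
    ultimately show "x \<in> carrier_vec k \<and> (\<exists>t. (\<forall>i<m. 0 \<le> t i \<and> t i \<le> 1) \<and>
       (\<forall>j<k. x $ j - \<rho> * (\<Sum>i<m. t i * z i $ j) \<in> \<int>))" using t by blast
  next
    assume "x \<in> carrier_vec k \<and> (\<exists>t. (\<forall>i<m. 0 \<le> t i \<and> t i \<le> 1) \<and>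
       (\<forall>j<k. x $ j - \<rho> * (\<Sum>i<m. t i * z i $ j) \<in> \<int>))"
    then obtain t where x: "x \<in> carrier_vec k" and t: "\<forall>i<m. 0 \<le> t i \<and> t i \<le> 1"
      and int: "\<forall>j<k. x $ j - \<rho> * (\<Sum>i<m. t i * z i $ j) \<in> \<int>" by blast
    define l where "l = vec k (\<lambda>j. x $ j - \<rho> * (\<Sum>i<m. t i * z i $ j))"
    have "l \<in> int_lattice k" using int by (simp add: l_def int_lattice_def)
    moreover have "x = \<rho> \<cdot>\<^sub>v ?w t + l"
      using x by (intro eq_vecI) (auto simp: l_def)
    moreover have "?w t \<in> zonotope k m z" using t Z by blast
    ultimately show "x \<in> ?S" by blast
  qed
  have "?S = carrier_vec k \<longleftrightarrow> (\<forall>x\<in>carrier_vec k. x \<in> ?S)" using S by blast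
  thus ?thesis unfolding lattice_covers_def using S by simp
qed

text \<open>
  Rounding down the coordinates with respect to the basis \<open>z i\<close>, \<open>i \<in> I\<close>, moves any point into
  the parallelepiped of this basis by a lattice vector.
\<close>

lemma lattice_covers_parallelepiped:
  assumes z: "\<And>i. i < m \<Longrightarrow> z i \<in> int_lattice k"
    and I: "I \<subseteq> {..<m}" "card I = k" "indpt_family k z I"
  shows "lattice_covers k (zonotope k m z) 1"
proof (subst lattice_covers_zonotope_iff)
  show "z i \<in> carrier_vec k" if "i < m" for i using z[OF that] by (rule int_latticeD)
  have fin: "finite I" using I(1) finite_subset by blast
  show "(0::real) < 1 \<and> (\<forall>x\<in>carrier_vec k. \<exists>t. (\<forall>i<m. 0 \<le> t i \<and> t i \<le> 1) \<and>
       (\<forall>j<k. x $ j - 1 * (\<Sum>i<m. t i * z i $ j) \<in> \<int>))"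
  proof (intro conjI ballI)
    fix x :: "real vec" assume "x \<in> carrier_vec k"
    then obtain c where c: "\<And>j. j < k \<Longrightarrow> x $ j = (\<Sum>i\<in>I. c i * z i $ j)"
      using indpt_family_spans[of I z k x] fin I z int_latticeD by (metis lessThan_iff subsetD)
    define t where "t i = (if i \<in> I then frac (c i) else 0)" for i
    have "x $ j - 1 * (\<Sum>i<m. t i * z i $ j) \<in> \<int>" if j: "j < k" for j
    proof -
      have "(\<Sum>i<m. t i * z i $ j) = (\<Sum>i\<in>I. t i * z i $ j)"
        by (rule sum.mono_neutral_right) (use I in \<open>auto simp: t_def\<close>)
      also have "\<dots> = (\<Sum>i\<in>I. c i * z i $ j - of_int \<lfloor>c i\<rfloor> * z i $ j)"
        by (rule sum.cong) (auto simp: t_def frac_def algebra_simps)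
      finally have "x $ j - 1 * (\<Sum>i<m. t i * z i $ j) = (\<Sum>i\<in>I. of_int \<lfloor>c i\<rfloor> * z i $ j)"
        using c[OF j] by (simp add: sum_subtractf)
      also have "\<dots> \<in> \<int>"
        using I z j by (intro Ints_sum Ints_mult) (auto simp: int_lattice_def)
      finally show ?thesis .
    qed
    moreover have "\<forall>i<m. 0 \<le> t i \<and> t i \<le> 1"
      by (auto simp: t_def frac_lt_1 less_imp_le)
    ultimately show "\<exists>t. (\<forall>i<m. 0 \<le> t i \<and> t i \<le> 1) \<and>
       (\<forall>j<k. x $ j - 1 * (\<Sum>i<m. t i * z i $ j) \<in> \<int>)" by blast
  qed simp
qed

lemma lattice_covers_general_position:
  assumes z: "\<And>i. i < m \<Longrightarrow> z i \<in> int_lattice k"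
    and "linear_general_position k m z" "k \<le> m"
  shows "lattice_covers k (zonotope k m z) 1"
proof (rule lattice_covers_parallelepiped[of _ _ _ "{..<k}"])
  show "indpt_family k z {..<k}"
    using assms linear_general_position_iff[of m z k] int_latticeD by auto
qed (use assms in auto)

lemma lattice_covers_add_generator:
  assumes z: "\<And>i. i < Suc m \<Longrightarrow> z i \<in> carrier_vec k"
    and cov: "lattice_covers k (zonotope k m z) \<rho>"
  shows "lattice_covers k (zonotope k (Suc m) z) \<rho>"
proof -
  have pos: "\<rho> > 0" using cov by (simp add: lattice_covers_def)
  have "\<exists>t. (\<forall>i<Suc m. 0 \<le> t i \<and> t i \<le> 1) \<and>
      (\<forall>j<k. x $ j - \<rho> * (\<Sum>i<Suc m. t i * z i $ j) \<in> \<int>)" if x: "x \<in> carrier_vec k" for x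
  proof -
    obtain t where t: "\<forall>i<m. 0 \<le> t i \<and> t i \<le> 1"
      "\<forall>j<k. x $ j - \<rho> * (\<Sum>i<m. t i * z i $ j) \<in> \<int>"
      using cov x z by (subst (asm) lattice_covers_zonotope_iff) auto
    show ?thesis
      by (rule exI[of _ "t(m := 0)"]) (use t in \<open>auto simp: less_Suc_eq\<close>)
  qed
  thus ?thesis using pos z by (subst lattice_covers_zonotope_iff) auto
qed

lemma lattice_covers_project:
  assumes z: "\<And>i. i < m \<Longrightarrow> z i \<in> carrier_vec k"
    and w: "\<And>i. i < Suc m \<Longrightarrow> w i \<in> carrier_vec (Suc k)"
    and proj: "\<And>i j. i < m \<Longrightarrow> j < k \<Longrightarrow> w i $ j = z i $ j"
    and vertical: "\<And>j. j < k \<Longrightarrow> w m $ j = 0"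
    and cov: "lattice_covers (Suc k) (zonotope (Suc k) (Suc m) w) \<rho>"
  shows "lattice_covers k (zonotope k m z) \<rho>"
proof -
  have pos: "\<rho> > 0" using cov by (simp add: lattice_covers_def)
  have "\<exists>t. (\<forall>i<m. 0 \<le> t i \<and> t i \<le> 1) \<and>
      (\<forall>j<k. x $ j - \<rho> * (\<Sum>i<m. t i * z i $ j) \<in> \<int>)" if x: "x \<in> carrier_vec k" for x
  proof -
    let ?x = "vec (Suc k) (\<lambda>j. if j < k then x $ j else 0)"
    have "?x \<in> carrier_vec (Suc k)" by simp
    then obtain t where t: "\<forall>i<Suc m. 0 \<le> t i \<and> t i \<le> 1"
      "\<forall>j<Suc k. ?x $ j - \<rho> * (\<Sum>i<Suc m. t i * w i $ j) \<in> \<int>"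
      using cov w by (subst (asm) lattice_covers_zonotope_iff) blast+
    have "x $ j - \<rho> * (\<Sum>i<m. t i * z i $ j) \<in> \<int>" if j: "j < k" for j
    proof -
      have "(\<Sum>i<Suc m. t i * w i $ j) = (\<Sum>i<m. t i * z i $ j)"
        using j by (simp add: proj vertical)
      thus ?thesis using t(2)[rule_format, of j] j by simp
    qed
    thus ?thesis using t(1) by (intro exI[of _ t]) auto
  qed
  thus ?thesis using pos z by (subst lattice_covers_zonotope_iff) auto
qed

section \<open>Lifting a family in general position\<close>

definition vertical_lift :: "nat \<Rightarrow> nat \<Rightarrow> (nat \<Rightarrow> real vec) \<Rightarrow> nat \<Rightarrow> nat \<Rightarrow> real vec" where
  "vertical_lift k m z N i =
     vec (Suc k) (\<lambda>j. if j < k then (if i < m then z i $ j else 0)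
                      else (if i < m then real N ^ i else 1))"

lemma vertical_lift_int_lattice:
  assumes "\<And>i. i < m \<Longrightarrow> z i \<in> int_lattice k"
  shows "vertical_lift k m z N i \<in> int_lattice (Suc k)"
  using assms by (auto simp: vertical_lift_def int_lattice_def)

text \<open>
  The relations among \<open>k + 1\<close> of the vectors \<open>z i\<close> are the multiples of a single relation \<open>c\<close>,
  since any \<open>k\<close> of these vectors are independent. So their lifts are dependent only if the heights
  satisfy \<open>\<Sum> c i * N ^ i = 0\<close>, which makes \<open>N\<close> a root of a polynomial with coefficients \<open>c\<close>.
  There are finitely many choices of \<open>k + 1\<close> vectors, hence finitely many \<open>N\<close> to avoid.
\<close>

lemma exists_generic_lift:
  assumes zC: "\<And>i. i < m \<Longrightarrow> z i \<in> carrier_vec k"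
    and gp: "linear_general_position k m z"
  shows "\<exists>N. linear_general_position (Suc k) (Suc m) (vertical_lift k m z N)"
proof -
  have ind: "indpt_family k z J" if "J \<subseteq> {..<m}" "card J = k" for J
    using gp linear_general_position_iff[of m z k] zC that by blast
  define \<I> where "\<I> = {I. I \<subseteq> {..<m} \<and> card I = Suc k}"
  have "\<forall>I\<in>\<I>. \<exists>c. (\<forall>j<k. (\<Sum>i\<in>I. c i * z i $ j) = 0) \<and> (\<exists>i\<in>I. c i \<noteq> 0)"
  proof
    fix I assume I: "I \<in> \<I>"
    hence "finite I" using finite_subset unfolding \<I>_def by blast
    hence "\<not> indpt_family k z I"
      using indpt_family_card_le[of I z k] I zC unfolding \<I>_def by fastforce
    thus "\<exists>c. (\<forall>j<k. (\<Sum>i\<in>I. c i * z i $ j) = 0) \<and> (\<exists>i\<in>I. c i \<noteq> 0)"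
      unfolding indpt_family_def by blast
  qed
  then obtain c where c: "\<And>I j. I \<in> \<I> \<Longrightarrow> j < k \<Longrightarrow> (\<Sum>i\<in>I. c I i * z i $ j) = 0"
    and cnz: "\<And>I. I \<in> \<I> \<Longrightarrow> \<exists>i\<in>I. c I i \<noteq> 0"
    by (auto simp: bchoice_iff)
  define p where "p I = (\<Sum>i\<in>I. monom (c I i) i)" for I
  have poly_p: "poly (p I) x = (\<Sum>i\<in>I. c I i * x ^ i)" for I x
    by (simp add: p_def poly_sum poly_monom)
  have finI: "finite I" if "I \<in> \<I>" for I using that finite_subset unfolding \<I>_def by blast
  have pnz: "p I \<noteq> 0" if I: "I \<in> \<I>" for I
  proof -
    obtain i where i: "i \<in> I" "c I i \<noteq> 0" using cnz I by blast
    have "coeff (p I) i = c I i"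
      using i finI[OF I] by (simp add: p_def coeff_sum)
    thus ?thesis using i by auto
  qed
  have "finite \<I>" unfolding \<I>_def by (rule finite_subset[of _ "Pow {..<m}"]) auto
  hence "finite (\<Union>I\<in>\<I>. {x. poly (p I) x = 0})" using pnz poly_roots_finite by blast
  hence "finite {N::nat. real N \<in> (\<Union>I\<in>\<I>. {x. poly (p I) x = 0})}"
    by (intro finite_vimageI[of _ real, unfolded vimage_def]) (auto simp: inj_on_def)
  then obtain N :: nat where "real N \<notin> (\<Union>I\<in>\<I>. {x. poly (p I) x = 0})"
    using ex_new_if_finite[OF infinite_UNIV_nat] by blast
  hence N: "(\<Sum>i\<in>I. c I i * real N ^ i) \<noteq> 0" if "I \<in> \<I>" for I using that poly_p by auto
  let ?w = "vertical_lift k m z N"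
  have wC: "?w i \<in> carrier_vec (Suc k)" for i by (simp add: vertical_lift_def)
  have w_low: "?w i $ j = z i $ j" if "i < m" "j < k" for i j
    using that by (simp add: vertical_lift_def)
  have w_top: "?w i $ k = real N ^ i" if "i < m" for i
    using that by (simp add: vertical_lift_def)
  have w_last: "?w m $ j = (if j = k then 1 else 0)" if "j \<le> k" for j
    using that by (simp add: vertical_lift_def)
  have "indpt_family (Suc k) ?w I" if I: "I \<subseteq> {..<Suc m}" "card I = Suc k" for I
    unfolding indpt_family_def
  proof (intro allI impI)
    fix d assume d: "\<forall>j<Suc k. (\<Sum>i\<in>I. d i * ?w i $ j) = 0"
    have fin: "finite I" using I(1) finite_subset by blast
    show "\<forall>i\<in>I. d i = 0"
    proof (cases "m \<in> I")
      case True
      \<comment> \<open>The vertical vector contributes only to the last coordinate.\<close>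
      let ?J = "I - {m}"
      have J: "?J \<subseteq> {..<m}" "card ?J = k" using I True fin by auto
      have split: "(\<Sum>i\<in>I. d i * ?w i $ j) = d m * ?w m $ j + (\<Sum>i\<in>?J. d i * ?w i $ j)" for j
        using True fin by (simp add: sum.remove)
      have "(\<Sum>i\<in>?J. d i * z i $ j) = 0" if "j < k" for j
      proof -
        have "(\<Sum>i\<in>?J. d i * z i $ j) = (\<Sum>i\<in>?J. d i * ?w i $ j)"
          using J(1) w_low that by (intro sum.cong) auto
        also have "\<dots> = 0" using d[rule_format, of j] that by (simp add: split w_last)
        finally show ?thesis .
      qed
      hence dJ: "\<forall>i\<in>?J. d i = 0"
        using ind[OF J] unfolding indpt_family_def by blast
      have "d m = 0" using d[rule_format, of k] dJ by (simp add: split w_last)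
      thus ?thesis using dJ by blast
    next
      case False
      hence Im: "I \<subseteq> {..<m}" using I by (auto simp: less_Suc_eq)
      hence IF: "I \<in> \<I>" using I by (simp add: \<I>_def)
      obtain i0 where i0: "i0 \<in> I" "c I i0 \<noteq> 0" using cnz[OF IF] by blast
      define r where "r = d i0 / c I i0"
      let ?J = "I - {i0}"
      have J: "?J \<subseteq> {..<m}" "card ?J = k" using Im I i0 fin by auto
      \<comment> \<open>Subtracting the multiple of \<open>c I\<close> that cancels the coefficient of \<open>i0\<close> leaves a relation
        among \<open>k\<close> vectors.\<close>
      have "(\<Sum>i\<in>?J. (d i - r * c I i) * z i $ j) = 0" if "j < k" for j
      proof -
        have "(\<Sum>i\<in>I. d i * z i $ j) = (\<Sum>i\<in>I. d i * ?w i $ j)"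
          using Im that by (intro sum.cong) (auto simp: w_low)
        hence "(\<Sum>i\<in>I. d i * z i $ j) = 0" using d that by simp
        moreover have "(\<Sum>i\<in>I. r * (c I i * z i $ j)) = 0"
          using c[OF IF that] by (simp flip: sum_distrib_left)
        ultimately have "(\<Sum>i\<in>I. (d i - r * c I i) * z i $ j) = 0"
          by (simp add: left_diff_distrib sum_subtractf mult.assoc)
        thus ?thesis using i0 fin by (simp add: sum.remove[of I i0] r_def)
      qed
      hence "\<forall>i\<in>?J. d i - r * c I i = 0"
        using ind[OF J] unfolding indpt_family_def
        by (drule_tac x = "\<lambda>i. d i - r * c I i" in spec) blast
      hence dr: "d i = r * c I i" if "i \<in> I" for i
        using that i0 by (cases "i = i0") (auto simp: r_def)
      have "r * (\<Sum>i\<in>I. c I i * real N ^ i) = (\<Sum>i\<in>I. d i * ?w i $ k)"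
        unfolding sum_distrib_left
        by (rule sum.cong) (use Im in \<open>auto simp: dr w_top\<close>)
      hence "r = 0" using d N[OF IF] by simp
      thus ?thesis using dr by simp
    qed
  qed
  hence "linear_general_position (Suc k) (Suc m) ?w"
    using linear_general_position_iff[of "Suc m" ?w "Suc k"] wC by blast
  thus ?thesis by blast
qed

section \<open>Comparison of admissible values\<close>

definition admissible :: "nat \<Rightarrow> nat \<Rightarrow> real set" where
  "admissible n m = {\<epsilon>. \<epsilon> \<ge> 0 \<and>
     (\<forall>k\<le>n. \<forall>z. (\<forall>i<m. z i \<in> int_lattice k) \<and> linear_general_position k m z \<longrightarrow>
        covering_radius k (zonotope k m z) \<le> 1 - 2 * \<epsilon>)}"

lemma zonotope_eps_eq_Sup: "zonotope_eps n m = Sup (admissible n m)"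
  by (simp add: zonotope_eps_def admissible_def)

lemma admissibleD:
  assumes "\<epsilon> \<in> admissible n m" "k \<le> n" "\<And>i. i < m \<Longrightarrow> z i \<in> int_lattice k"
    "linear_general_position k m z"
  shows "covering_radius k (zonotope k m z) \<le> 1 - 2 * \<epsilon>"
  using assms unfolding admissible_def by blast

lemma zero_admissible:
  assumes "n \<le> m"
  shows "0 \<in> admissible n m"
  using assms
  by (auto simp: admissible_def intro!: covering_radius_le lattice_covers_general_position)

lemma covering_radius_dim_0:
  assumes "\<And>i. i < m \<Longrightarrow> z i \<in> carrier_vec 0"
  shows "covering_radius 0 (zonotope 0 m z) = 0"
proof -
  have "lattice_covers 0 (zonotope 0 m z) \<rho> \<longleftrightarrow> \<rho> > 0" for \<rho>
    using assms by (subst lattice_covers_zonotope_iff) (auto intro: exI[of _ "\<lambda>_. 0"])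
  hence "{\<rho>. lattice_covers 0 (zonotope 0 m z) \<rho>} = {0<..}" by auto
  thus ?thesis unfolding covering_radius_eq_Inf by simp
qed

lemma admissible_le_half:
  assumes "\<epsilon> \<in> admissible n m"
  shows "\<epsilon> \<le> 1 / 2"
proof -
  let ?z = "\<lambda>i::nat. 0\<^sub>v 0 :: real vec"
  have "linear_general_position 0 m ?z"
    by (subst linear_general_position_iff)
       (auto simp: indpt_family_def dest: finite_subset[OF _ finite_lessThan])
  hence "covering_radius 0 (zonotope 0 m ?z) \<le> 1 - 2 * \<epsilon>"
    by (intro admissibleD[OF assms]) (auto simp: int_lattice_def)
  thus ?thesis by (simp add: covering_radius_dim_0)
qed

lemma zonotope_eps_mono:
  assumes "n \<le> m" "admissible n m \<subseteq> admissible n' m'"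
  shows "zonotope_eps n m \<le> zonotope_eps n' m'"
  unfolding zonotope_eps_eq_Sup
proof (rule cSup_subset_mono)
  show "admissible n m \<noteq> {}" using zero_admissible[OF assms(1)] by blast
  show "bdd_above (admissible n' m')" using admissible_le_half by (rule bdd_aboveI)
qed (rule assms(2))

lemma admissible_subset_dim:
  assumes "n' \<le> n"
  shows "admissible n m \<subseteq> admissible n' m"
  using assms unfolding admissible_def by force

lemma admissible_subset_add_generator:
  assumes "n \<le> m"
  shows "admissible n m \<subseteq> admissible n (Suc m)"
proof
  fix \<epsilon> assume \<epsilon>: "\<epsilon> \<in> admissible n m"
  have "covering_radius k (zonotope k (Suc m) z) \<le> 1 - 2 * \<epsilon>"
    if k: "k \<le> n" and z: "\<forall>i<Suc m. z i \<in> int_lattice k"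
      and gp: "linear_general_position k (Suc m) z" for k z
  proof -
    have gp': "linear_general_position k m z"
      using gp lessThan_subset_iff[of m "Suc m"] unfolding linear_general_position_def
      by (metis order_trans le_SucI order_refl)
    have "covering_radius k (zonotope k (Suc m) z) \<le> covering_radius k (zonotope k m z)"
    proof (rule covering_radius_mono)
      show "lattice_covers k (zonotope k m z) 1"
        using z gp' k assms by (intro lattice_covers_general_position) auto
    qed (use z int_latticeD in \<open>blast intro: lattice_covers_add_generator\<close>)
    also have "\<dots> \<le> 1 - 2 * \<epsilon>" using z gp' k by (intro admissibleD[OF \<epsilon>]) auto
    finally show ?thesis .
  qed
  thus "\<epsilon> \<in> admissible n (Suc m)" using \<epsilon> by (simp add: admissible_def)
qed

lemma admissible_subset_project:
  assumes "n \<le> m"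
  shows "admissible (Suc n) (Suc m) \<subseteq> admissible n m"
proof
  fix \<epsilon> assume \<epsilon>: "\<epsilon> \<in> admissible (Suc n) (Suc m)"
  have "covering_radius k (zonotope k m z) \<le> 1 - 2 * \<epsilon>"
    if k: "k \<le> n" and z: "\<forall>i<m. z i \<in> int_lattice k"
      and gp: "linear_general_position k m z" for k z
  proof -
    have zC: "z i \<in> carrier_vec k" if "i < m" for i using z that int_latticeD by blast
    obtain N where gp': "linear_general_position (Suc k) (Suc m) (vertical_lift k m z N)"
      using exists_generic_lift[OF zC gp] by blast
    let ?w = "vertical_lift k m z N"
    have w: "?w i \<in> int_lattice (Suc k)" for i using z by (intro vertical_lift_int_lattice) auto
    have "covering_radius k (zonotope k m z) \<le>
        covering_radius (Suc k) (zonotope (Suc k) (Suc m) ?w)"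
    proof (rule covering_radius_mono)
      show "lattice_covers (Suc k) (zonotope (Suc k) (Suc m) ?w) 1"
        using w gp' k assms by (intro lattice_covers_general_position) auto
      show "lattice_covers k (zonotope k m z) \<rho>"
        if "lattice_covers (Suc k) (zonotope (Suc k) (Suc m) ?w) \<rho>" for \<rho>
        by (rule lattice_covers_project[OF zC int_latticeD[OF w] _ _ that])
           (auto simp: vertical_lift_def)
    qed
    also have "\<dots> \<le> 1 - 2 * \<epsilon>" using w gp' k by (intro admissibleD[OF \<epsilon>]) auto
    finally show ?thesis .
  qed
  thus "\<epsilon> \<in> admissible n m" using \<epsilon> by (simp add: admissible_def)
qed

section \<open>Dimension one\<close>

lemma general_position_dim_1_iff:
  assumes "\<And>i. i < m \<Longrightarrow> z i \<in> carrier_vec 1"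
  shows "linear_general_position 1 m z \<longleftrightarrow> (\<forall>i<m. z i $ 0 \<noteq> 0)"
proof -
  have "indpt_family 1 z {i} \<longleftrightarrow> z i $ 0 \<noteq> 0" for i
    by (auto simp: indpt_family_def dest: spec[of _ "\<lambda>_. 1"])
  moreover have "(\<forall>I. I \<subseteq> {..<m} \<and> card I = 1 \<longrightarrow> indpt_family 1 z I) \<longleftrightarrow>
      (\<forall>i<m. indpt_family 1 z {i})"
    by (auto simp: card_1_singleton_iff)
  ultimately show ?thesis using linear_general_position_iff[of m z 1] assms by simp
qed

text \<open>
  As \<open>s\<close> runs from \<open>0\<close> to \<open>1\<close>, the point with coefficient \<open>s\<close> at the positive and \<open>1 - s\<close> at the
  negative generators runs linearly through the whole interval, from its left end \<open>- q\<close> to its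
  right end \<open>p - q\<close>, where \<open>p \<ge> m\<close> is the length of the interval.
\<close>

lemma covering_radius_dim_1_le:
  assumes m: "0 < m" and z: "\<And>i. i < m \<Longrightarrow> z i \<in> int_lattice 1"
    and gp: "linear_general_position 1 m z"
  shows "covering_radius 1 (zonotope 1 m z) \<le> 1 / real m"
proof (rule covering_radius_le, subst lattice_covers_zonotope_iff)
  show zC: "z i \<in> carrier_vec 1" if "i < m" for i using z[OF that] by (rule int_latticeD)
  have nz: "z i $ 0 \<noteq> 0" if "i < m" for i
    using gp general_position_dim_1_iff[of m z] zC that by blast
  define p where "p = (\<Sum>i<m. \<bar>z i $ 0\<bar>)"
  define q where "q = (\<Sum>i<m. if z i $ 0 < 0 then - z i $ 0 else 0)"
  have "(\<Sum>i<m. 1) \<le> p"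
    unfolding p_def
  proof (rule sum_mono)
    fix i assume "i \<in> {..<m}"
    thus "1 \<le> \<bar>z i $ 0\<bar>" using z nz by (intro Ints_nonzero_abs_ge1) (auto simp: int_lattice_def)
  qed
  hence p: "real m \<le> p" by simp
  show "0 < 1 / real m \<and> (\<forall>x\<in>carrier_vec 1. \<exists>t. (\<forall>i<m. 0 \<le> t i \<and> t i \<le> 1) \<and>
       (\<forall>j<1. x $ j - 1 / real m * (\<Sum>i<m. t i * z i $ j) \<in> \<int>))"
  proof (intro conjI ballI)
    fix x :: "real vec" assume "x \<in> carrier_vec 1"
    define f where "f = frac (x $ 0 + q / m)"
    define s where "s = m * f / p"
    define t where "t i = (if z i $ 0 < 0 then 1 - s else s)" for i
    have f: "0 \<le> f" "f \<le> 1" by (simp_all add: f_def frac_lt_1 less_imp_le)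
    have "real m * f \<le> p" using mult_left_mono[OF f(2), of "real m"] p by simp
    hence s: "0 \<le> s" "s \<le> 1" using f m p by (simp_all add: s_def divide_simps)
    have "(\<Sum>i<m. t i * z i $ 0) =
        (\<Sum>i<m. s * \<bar>z i $ 0\<bar> - (if z i $ 0 < 0 then - z i $ 0 else 0))"
      by (rule sum.cong) (auto simp: t_def algebra_simps)
    also have "\<dots> = s * p - q" by (simp add: sum_subtractf p_def q_def sum_distrib_left)
    also have "s * p = m * f" using p m by (simp add: s_def)
    finally have "x $ 0 - 1 / m * (\<Sum>i<m. t i * z i $ 0) = x $ 0 + q / m - f"
      using m by (simp add: field_simps)
    also have "\<dots> = of_int \<lfloor>x $ 0 + q / m\<rfloor>" by (simp add: f_def frac_def)
    finally have "x $ 0 - 1 / m * (\<Sum>i<m. t i * z i $ 0) \<in> \<int>" by simp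
    thus "\<exists>t. (\<forall>i<m. 0 \<le> t i \<and> t i \<le> 1) \<and>
       (\<forall>j<1. x $ j - 1 / real m * (\<Sum>i<m. t i * z i $ j) \<in> \<int>)"
      using s by (intro exI[of _ t]) (auto simp: t_def)
  qed (use m in simp)
qed

text \<open>
  The translates of an interval \<open>[0, \<rho> m]\<close> with \<open>\<rho> m < 1\<close> miss the midpoint of \<open>(\<rho> m, 1)\<close>.
\<close>

lemma covering_radius_unit_generators_ge:
  assumes m: "0 < m"
  shows "1 / real m \<le> covering_radius 1 (zonotope 1 m (\<lambda>_. vec 1 (\<lambda>_. 1)))"
  unfolding covering_radius_eq_Inf
proof (rule cInf_greatest)
  let ?z = "\<lambda>_::nat. vec 1 (\<lambda>_. 1) :: real vec"
  have "linear_general_position 1 m ?z" by (subst general_position_dim_1_iff) auto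
  hence "lattice_covers 1 (zonotope 1 m ?z) 1"
    using m by (intro lattice_covers_general_position) (auto simp: int_lattice_def)
  thus "{\<rho>. lattice_covers 1 (zonotope 1 m ?z) \<rho>} \<noteq> {}" by blast
  fix \<rho> assume "\<rho> \<in> {\<rho>. lattice_covers 1 (zonotope 1 m ?z) \<rho>}"
  hence "\<rho> > 0 \<and> (\<forall>x\<in>carrier_vec 1. \<exists>t. (\<forall>i<m. 0 \<le> t i \<and> t i \<le> 1) \<and>
       (\<forall>j<1. x $ j - \<rho> * (\<Sum>i<m. t i * ?z i $ j) \<in> \<int>))"
    by (subst (asm) mem_Collect_eq, subst (asm) lattice_covers_zonotope_iff) auto
  hence pos: "\<rho> > 0" and cov: "\<And>x. x \<in> carrier_vec 1 \<Longrightarrow>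
      \<exists>t. (\<forall>i<m. 0 \<le> t i \<and> t i \<le> 1) \<and> x $ 0 - \<rho> * (\<Sum>i<m. t i) \<in> \<int>" by auto
  show "1 / real m \<le> \<rho>"
  proof (rule ccontr)
    assume "\<not> 1 / real m \<le> \<rho>"
    hence less: "\<rho> * m < 1" using m by (simp add: field_simps)
    obtain t where t: "\<forall>i<m. 0 \<le> t i \<and> t i \<le> 1"
      and int: "(1 + \<rho> * m) / 2 - \<rho> * (\<Sum>i<m. t i) \<in> \<int>"
      using cov[of "vec 1 (\<lambda>_. (1 + \<rho> * m) / 2)"] by auto
    have "(\<Sum>i<m. t i) \<le> (\<Sum>i<m. 1)" using t by (intro sum_mono) auto
    hence "\<rho> * (\<Sum>i<m. t i) \<le> \<rho> * m" using pos by simp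
    moreover have "0 \<le> \<rho> * (\<Sum>i<m. t i)"
      using t pos by (intro mult_nonneg_nonneg sum_nonneg) auto
    ultimately have "0 < (1 + \<rho> * m) / 2 - \<rho> * (\<Sum>i<m. t i)"
      "(1 + \<rho> * m) / 2 - \<rho> * (\<Sum>i<m. t i) < 1" using less by (auto simp: field_simps)
    moreover obtain l where "(1 + \<rho> * m) / 2 - \<rho> * (\<Sum>i<m. t i) = of_int l"
      using int by (elim Ints_cases)
    ultimately show False by simp
  qed
qed

lemma zonotope_eps_dim_1:
  assumes m: "0 < m"
  shows "zonotope_eps 1 m = (1 - 1 / real m) / 2"
proof -
  have "admissible 1 m = {0..(1 - 1 / real m) / 2}"
  proof (intro equalityI subsetI)
    fix \<epsilon> assume \<epsilon>: "\<epsilon> \<in> admissible 1 m"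
    let ?z = "\<lambda>_::nat. vec 1 (\<lambda>_. 1) :: real vec"
    have "linear_general_position 1 m ?z" by (subst general_position_dim_1_iff) auto
    hence "covering_radius 1 (zonotope 1 m ?z) \<le> 1 - 2 * \<epsilon>"
      by (intro admissibleD[OF \<epsilon>]) (auto simp: int_lattice_def)
    hence "1 / real m \<le> 1 - 2 * \<epsilon>" using covering_radius_unit_generators_ge[OF m] by linarith
    thus "\<epsilon> \<in> {0..(1 - 1 / real m) / 2}" using \<epsilon> by (simp add: admissible_def)
  next
    fix \<epsilon> assume "\<epsilon> \<in> {0..(1 - 1 / real m) / 2}"
    hence \<epsilon>: "0 \<le> \<epsilon>" "1 / real m \<le> 1 - 2 * \<epsilon>" by auto
    have "covering_radius k (zonotope k m z) \<le> 1 - 2 * \<epsilon>"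
      if "k \<le> 1" and z: "\<forall>i<m. z i \<in> int_lattice k"
        and gp: "linear_general_position k m z" for k z
    proof -
      have "covering_radius k (zonotope k m z) \<le> 1 / real m"
      proof (cases "k = 0")
        case True
        thus ?thesis using z int_latticeD covering_radius_dim_0[of m z] by auto
      next
        case False
        hence "k = 1" using \<open>k \<le> 1\<close> by simp
        thus ?thesis using z gp m covering_radius_dim_1_le by blast
      qed
      thus ?thesis using \<epsilon> by linarith
    qed
    thus "\<epsilon> \<in> admissible 1 m" using \<epsilon> by (simp add: admissible_def)
  qed
  thus ?thesis using m by (simp add: zonotope_eps_eq_Sup)
qed

section \<open>Monotonicity and the value in dimension one\<close>

theorem proposition3p8:
  fixes n m :: nat
  assumes "1 \<le> n" and "n \<le> m"
  shows "(zonotope_eps n m \<le> zonotope_eps (n - 1) m \<and>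
          zonotope_eps n m \<le> zonotope_eps n (m + 1)) \<and>
         ((\<forall>i. i < n - 1 \<longrightarrow>
             zonotope_eps (n - i) (m - i) \<le> zonotope_eps (n - (i + 1)) (m - (i + 1))) \<and>
          zonotope_eps 1 (m - n + 1) = (real m - real n) / (2 * (real m - real n + 1)))"
proof (intro conjI allI impI)
  show "zonotope_eps n m \<le> zonotope_eps (n - 1) m"
    using assms by (intro zonotope_eps_mono admissible_subset_dim) auto
  show "zonotope_eps n m \<le> zonotope_eps n (m + 1)"
    using assms admissible_subset_add_generator by (intro zonotope_eps_mono) auto
next
  fix i assume i: "i < n - 1"
  have suc: "n - i = Suc (n - (i + 1))" "m - i = Suc (m - (i + 1))" using i assms by auto
  show "zonotope_eps (n - i) (m - i) \<le> zonotope_eps (n - (i + 1)) (m - (i + 1))"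
    unfolding suc using assms by (intro zonotope_eps_mono admissible_subset_project) auto
next
  show "zonotope_eps 1 (m - n + 1) = (real m - real n) / (2 * (real m - real n + 1))"
    using assms by (subst zonotope_eps_dim_1) (auto simp: of_nat_diff field_simps)
qed

end
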